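(* Let $P=(S,\le_P)$ be a poset with $|S|=n$, let $g:\{1,\dots,n\}\to S$ be a bijection, and assume $S$ and $\{1,\dots,n\}$ are disjoint. Let $G_P$ be the graph with vertex set $S\cup\{1,\dots,n\}$ in which $\{1,\dots,n\}$ is a clique, $S$ is an independent set, and for $u\in S$, $v\in\{1,\dots,n\}$, $u$ and $v$ are adjacent if and only if $g(v)\le_P u$. Then $\dim(P)\ge t(\overline{G_P})$.
   Context: $\overline{G}$ denotes the complement of a graph $G$. A threshold graph is a graph $G=(V,E)$ admitting a real $S$ and $w:V\to\mathbb{R}$ with $uv\in E$ iff $w(u)+w(v)\ge S$ (for distinct $u,v$). The threshold dimension $t(G)$ is the least $k$ such that there are threshold graphs $G_1,\dots,G_k$ on $V(G)$ with $E(G)=\bigcup_i E(G_i)$. For a poset $P$, $\dim(P)$ is the minimum number of linear extensions of $P$ (total orders extending $\le_P$) such that for every incomparable pair $x,y$ some extension has $x<y$ and some has $y<x$. *)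

theory Defs
  imports Complex_Main
begin

record 'v ugraph =
  verts :: "'v set"
  edges :: "'v set set"

definition vertex_pairs :: "'v set \<Rightarrow> 'v set set" where
  "vertex_pairs V = {{u, v} | u v. u \<in> V \<and> v \<in> V \<and> u \<noteq> v}"

definition simple_graph :: "'v ugraph \<Rightarrow> bool" where
  "simple_graph G \<longleftrightarrow> edges G \<subseteq> vertex_pairs (verts G)"

definition complement_graph :: "'v ugraph \<Rightarrow> 'v ugraph" where
  "complement_graph G = \<lparr>verts = verts G, edges = vertex_pairs (verts G) - edges G\<rparr>"

definition threshold_graph :: "'v ugraph \<Rightarrow> bool" where
  "threshold_graph G \<longleftrightarrow> simple_graph G \<and>
     (\<exists>(s::real) (w::'v \<Rightarrow> real). \<forall>u\<in>verts G. \<forall>v\<in>verts G. u \<noteq> v \<longrightarrow>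
        ({u, v} \<in> edges G \<longleftrightarrow> w u + w v \<ge> s))"

text \<open>The least \<open>k\<close> exists for every finite graph (each single edge gives a threshold graph);
  an edgeless graph has threshold dimension 0.\<close>

definition threshold_dim :: "'v ugraph \<Rightarrow> nat" where
  "threshold_dim G = (LEAST k. \<exists>H :: nat \<Rightarrow> 'v ugraph.
     (\<forall>i\<in>{1..k}. threshold_graph (H i) \<and> verts (H i) = verts G) \<and>
     edges G = (\<Union>i\<in>{1..k}. edges (H i)))"

definition linear_extension :: "'a set \<Rightarrow> 'a rel \<Rightarrow> 'a rel \<Rightarrow> bool" where
  "linear_extension S P L \<longleftrightarrow> linear_order_on S L \<and> P \<subseteq> L"

text \<open>A realizer is nonempty, so that a chain has dimension 1, as usual; without this a chain
  would vacuously have dimension 0. Incomparable elements are distinct, hence \<open>(x, y) \<in> L\<close>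
  below means that \<open>x\<close> is strictly below \<open>y\<close> in \<open>L\<close>.\<close>

definition realizer :: "'a set \<Rightarrow> 'a rel \<Rightarrow> 'a rel set \<Rightarrow> bool" where
  "realizer S P R \<longleftrightarrow> R \<noteq> {} \<and> (\<forall>L\<in>R. linear_extension S P L) \<and>
     (\<forall>x\<in>S. \<forall>y\<in>S. (x, y) \<notin> P \<and> (y, x) \<notin> P \<longrightarrow>
        (\<exists>L\<in>R. (x, y) \<in> L) \<and> (\<exists>L\<in>R. (y, x) \<in> L))"

definition poset_dim :: "'a set \<Rightarrow> 'a rel \<Rightarrow> nat" where
  "poset_dim S P = (LEAST k. \<exists>R. finite R \<and> card R = k \<and> realizer S P R)"

text \<open>The sum type makes \<open>S\<close> and \<open>{1..n}\<close> disjoint: \<open>Inl u\<close> is the vertex \<open>u \<in> S\<close> and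
  \<open>Inr v\<close> the vertex \<open>v \<in> {1..n}\<close>.\<close>

definition poset_graph :: "'a set \<Rightarrow> 'a rel \<Rightarrow> nat \<Rightarrow> (nat \<Rightarrow> 'a) \<Rightarrow> ('a + nat) ugraph" where
  "poset_graph S P n g =
     \<lparr>verts = S <+> {1..n},
      edges = {{Inr i, Inr j} | i j. i \<in> {1..n} \<and> j \<in> {1..n} \<and> i \<noteq> j}
        \<union> {{Inl u, Inr v} | u v. u \<in> S \<and> v \<in> {1..n} \<and> (g v, u) \<in> P}\<rparr>"

end

theory Submission
  imports Defs
begin

text \<open>Each linear extension \<open>L\<close> of a realizer gives a threshold graph: with \<open>r\<close> the rank in
  \<open>L\<close>, put weight \<open>n + 1 - r(u)\<close> on \<open>u \<in> S\<close> and \<open>r(g(v)) - (n + 1)\<close> on \<open>v \<in> {1..n}\<close>, with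
  threshold 1. Then \<open>S\<close> is a clique, \<open>{1..n}\<close> is independent, and \<open>u\<close>, \<open>v\<close> are adjacent iff
  \<open>u\<close> lies strictly below \<open>g(v)\<close> in \<open>L\<close>. Since \<open>\<not> g(v) \<le>\<^sub>P u\<close> holds iff \<open>u\<close> is strictly
  below \<open>g(v)\<close> in some extension of the realizer, these graphs cover exactly the edges of the
  complement of \<open>G\<^sub>P\<close>.\<close>

section \<open>Linear extensions and realizers of finite partial orders\<close>

text \<open>The added pairs are those that transitivity forces once \<open>x\<close> is placed below
  \<open>y\<close>. A cycle through an added pair would give \<open>(y, x) \<in> P\<close> by
  transitivity, so antisymmetry survives.\<close>

lemma partial_order_on_insert_pair:
  assumes P: "partial_order_on S P" and xy: "x \<in> S" "y \<in> S" "(y, x) \<notin> P"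
  shows "partial_order_on S (P \<union> {(a, b). (a, x) \<in> P \<and> (y, b) \<in> P})"
proof -
  have PS: "P \<subseteq> S \<times> S" and re: "\<And>a. a \<in> S \<Longrightarrow> (a, a) \<in> P"
    and tr: "\<And>a b c. (a, b) \<in> P \<Longrightarrow> (b, c) \<in> P \<Longrightarrow> (a, c) \<in> P"
    and an: "\<And>a b. (a, b) \<in> P \<Longrightarrow> (b, a) \<in> P \<Longrightarrow> a = b"
    using P unfolding partial_order_on_def preorder_on_def refl_on_def trans_def antisym_def
    by blast+
  show ?thesis
    unfolding partial_order_on_def preorder_on_def
  proof (intro conjI)
    show "P \<union> {(a, b). (a, x) \<in> P \<and> (y, b) \<in> P} \<subseteq> S \<times> S"
      using PS by blast
    show "refl_on S (P \<union> {(a, b). (a, x) \<in> P \<and> (y, b) \<in> P})"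
      using re by (auto simp: refl_on_def)
    show "trans (P \<union> {(a, b). (a, x) \<in> P \<and> (y, b) \<in> P})"
      by (rule transI) (auto intro: tr)
    show "antisym (P \<union> {(a, b). (a, x) \<in> P \<and> (y, b) \<in> P})"
      using xy(3) by (intro antisymI) (auto intro: an dest: tr)
  qed
qed

text \<open>Szpilrajn's theorem for finite sets: a partial order maximal among those containing
  \<open>P\<close> must be total, since otherwise an incomparable pair could be inserted.\<close>

lemma linear_extension_exists:
  assumes "finite S" "partial_order_on S P"
  obtains L where "linear_extension S P L"
proof -
  define Q where "Q = {L. partial_order_on S L \<and> P \<subseteq> L}"
  have "Q \<subseteq> Pow (S \<times> S)"
    by (auto simp: Q_def partial_order_on_def preorder_on_def)
  then have "finite Q"
    using assms(1) by (meson finite_Pow_iff finite_SigmaI finite_subset)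
  moreover have "Q \<noteq> {}"
    using assms(2) by (auto simp: Q_def)
  ultimately obtain L where L: "L \<in> Q" and mx: "\<And>M. M \<in> Q \<Longrightarrow> L \<subseteq> M \<Longrightarrow> L = M"
    using finite_has_maximal by metis
  have po: "partial_order_on S L" and PL: "P \<subseteq> L"
    using L by (auto simp: Q_def)
  have "total_on S L"
  proof (rule total_onI, rule ccontr)
    fix x y assume xy: "x \<in> S" "y \<in> S" "\<not> ((x, y) \<in> L \<or> (y, x) \<in> L)"
    let ?M = "L \<union> {(a, b). (a, x) \<in> L \<and> (y, b) \<in> L}"
    have "?M \<in> Q"
      using partial_order_on_insert_pair[OF po] xy PL unfolding Q_def by blast
    then have "L = ?M"
      using mx by blast
    \<comment> \<open>Reflexivity at \<open>x\<close> and \<open>y\<close> puts the pair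
      \<open>(x, y)\<close> itself into \<open>?M\<close>, hence into \<open>L\<close>.\<close>
    moreover have "(x, x) \<in> L" "(y, y) \<in> L"
      using po xy by (auto simp: partial_order_on_def preorder_on_def refl_on_def)
    ultimately show False
      using xy by blast
  qed
  then show thesis
    using po PL that by (auto simp: linear_extension_def linear_order_on_def)
qed

text \<open>The pair is inserted into \<open>P\<close> first, and the enlarged order is then
  linearized.\<close>

lemma linear_extension_with_pair:
  assumes "finite S" "partial_order_on S P" "x \<in> S" "y \<in> S" "(y, x) \<notin> P"
  obtains L where "linear_extension S P L" "(x, y) \<in> L"
proof -
  let ?M = "P \<union> {(a, b). (a, x) \<in> P \<and> (y, b) \<in> P}"
  have "partial_order_on S ?M"
    using partial_order_on_insert_pair assms by metis
  then obtain L where L: "linear_extension S ?M L"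
    using linear_extension_exists assms(1) by metis
  have "(x, x) \<in> P" "(y, y) \<in> P"
    using assms by (auto simp: partial_order_on_def preorder_on_def refl_on_def)
  then show thesis
    using L that[of L] unfolding linear_extension_def by blast
qed

text \<open>Provides a finite realizer, so that the \<open>LEAST\<close> in \<open>poset_dim\<close>
  is attained.\<close>

lemma realizer_all_linear_extensions:
  assumes "finite S" "partial_order_on S P"
  shows "finite {L. linear_extension S P L}" "realizer S P {L. linear_extension S P L}"
proof -
  have "{L. linear_extension S P L} \<subseteq> Pow (S \<times> S)"
    by (auto simp: linear_extension_def linear_order_on_def partial_order_on_def preorder_on_def)
  then show "finite {L. linear_extension S P L}"
    using assms(1) by (meson finite_Pow_iff finite_SigmaI finite_subset)
  show "realizer S P {L. linear_extension S P L}"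
    unfolding realizer_def
  proof (intro conjI ballI impI)
    show "{L. linear_extension S P L} \<noteq> {}"
      using linear_extension_exists[OF assms] by blast
  next
    fix x y assume "x \<in> S" "y \<in> S" "(x, y) \<notin> P \<and> (y, x) \<notin> P"
    then show "\<exists>L\<in>{L. linear_extension S P L}. (x, y) \<in> L"
      and "\<exists>L\<in>{L. linear_extension S P L}. (y, x) \<in> L"
      using linear_extension_with_pair[OF assms] by (metis mem_Collect_eq)+
  qed simp
qed

lemma poset_dim_realizer:
  assumes "finite S" "partial_order_on S P"
  obtains R where "finite R" "card R = poset_dim S P" "realizer S P R"
proof -
  have "\<exists>R. finite R \<and> card R = poset_dim S P \<and> realizer S P R"
    unfolding poset_dim_def
    by (rule LeastI_ex) (use realizer_all_linear_extensions[OF assms] in blast)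
  then show thesis
    using that by blast
qed

section \<open>Threshold covers and graphs given by vertex weights\<close>

text \<open>Replaces the indices \<open>{1..k}\<close> of the definition by an arbitrary finite set,
  so that a cover can be indexed by the orders of a realizer.\<close>

lemma threshold_dim_le_card:
  assumes "finite I"
    and "\<And>i. i \<in> I \<Longrightarrow> threshold_graph (H i) \<and> verts (H i) = verts G"
    and "edges G = (\<Union>i\<in>I. edges (H i))"
  shows "threshold_dim G \<le> card I"
proof -
  obtain h where h: "bij_betw h {1..card I} I"
    using ex_bij_betw_nat_finite_1[OF assms(1)] by blast
  then have im: "h ` {1..card I} = I"
    by (rule bij_betw_imp_surj_on)
  have "edges G = (\<Union>i\<in>{1..card I}. edges ((H \<circ> h) i))"
    unfolding assms(3) by (subst im[symmetric]) (simp add: image_image)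
  moreover have "\<forall>i\<in>{1..card I}. threshold_graph ((H \<circ> h) i) \<and> verts ((H \<circ> h) i) = verts G"
    using assms(2) im by auto
  ultimately show ?thesis
    unfolding threshold_dim_def by (intro Least_le) blast
qed

lemma pair_in_vertex_pairs_iff: "{u, v} \<in> vertex_pairs V \<longleftrightarrow> u \<in> V \<and> v \<in> V \<and> u \<noteq> v"
  unfolding vertex_pairs_def by (auto simp: doubleton_eq_iff)

definition weight_graph :: "'v set \<Rightarrow> real \<Rightarrow> ('v \<Rightarrow> real) \<Rightarrow> 'v ugraph" where
  "weight_graph V s w = \<lparr>verts = V,
     edges = {{u, v} | u v. u \<in> V \<and> v \<in> V \<and> u \<noteq> v \<and> w u + w v \<ge> s}\<rparr>"

lemma verts_weight_graph [simp]: "verts (weight_graph V s w) = V"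
  by (simp add: weight_graph_def)

lemma edge_weight_graph_iff:
  assumes "u \<in> V" "v \<in> V" "u \<noteq> v"
  shows "{u, v} \<in> edges (weight_graph V s w) \<longleftrightarrow> w u + w v \<ge> s"
  using assms by (auto simp: weight_graph_def doubleton_eq_iff add.commute)

lemma edges_weight_graph_subset: "edges (weight_graph V s w) \<subseteq> vertex_pairs V"
  by (auto simp: weight_graph_def vertex_pairs_def)

lemma threshold_graph_weight_graph: "threshold_graph (weight_graph V s w)"
  unfolding threshold_graph_def simple_graph_def
  using edges_weight_graph_subset edge_weight_graph_iff by (metis verts_weight_graph)

lemma edges_eqI:
  assumes "A \<subseteq> vertex_pairs V" "B \<subseteq> vertex_pairs V"
    and "\<And>u v. u \<in> V \<Longrightarrow> v \<in> V \<Longrightarrow> u \<noteq> v \<Longrightarrow> {u, v} \<in> A \<longleftrightarrow> {u, v} \<in> B"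
  shows "A = B"
proof (rule set_eqI)
  fix e
  show "e \<in> A \<longleftrightarrow> e \<in> B"
  proof (cases "e \<in> vertex_pairs V")
    case True
    then show ?thesis
      using assms(3) by (auto simp: vertex_pairs_def)
  qed (use assms in blast)
qed

section \<open>Ranks in a linear order\<close>

text \<open>For a reflexive \<open>L\<close> the count includes \<open>x\<close> itself, so the
  least element of a finite linear order has rank 1.\<close>

definition rank :: "'a rel \<Rightarrow> 'a \<Rightarrow> nat" where
  "rank L x = card {z. (z, x) \<in> L}"

lemma rank_le_card:
  assumes "finite S" "linear_order_on S L"
  shows "rank L x \<le> card S"
  unfolding rank_def using assms
  by (intro card_mono)
    (auto simp: linear_order_on_def partial_order_on_def preorder_on_def)

text \<open>By totality, \<open>(y, x) \<notin> L\<close> means that \<open>x\<close> is strictly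
  below \<open>y\<close>; the down-set of \<open>x\<close> is then properly contained in that of
  \<open>y\<close>, which alone contains \<open>y\<close>.\<close>

lemma rank_less_iff:
  assumes "finite S" "linear_order_on S L" "x \<in> S" "y \<in> S"
  shows "rank L x < rank L y \<longleftrightarrow> (y, x) \<notin> L"
proof -
  have LS: "L \<subseteq> S \<times> S" and re: "\<And>a. a \<in> S \<Longrightarrow> (a, a) \<in> L"
    and "trans L" and total: "total_on S L"
    using assms(2)
    by (auto simp: linear_order_on_def partial_order_on_def preorder_on_def refl_on_def)
  have tr: "(a, c) \<in> L" if "(a, b) \<in> L" "(b, c) \<in> L" for a b c
    using \<open>trans L\<close> that by (rule transD)
  have tot: "(a, b) \<in> L \<or> (b, a) \<in> L" if "a \<in> S" "b \<in> S" for a b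
    using total re that by (cases "a = b") (auto simp: total_on_def)
  have fin: "finite {z. (z, a) \<in> L}" for a
    using LS by (intro finite_subset[OF _ assms(1)]) blast
  show ?thesis
  proof
    assume "(y, x) \<notin> L"
    then have "{z. (z, x) \<in> L} \<subset> {z. (z, y) \<in> L}"
      using tot re tr assms(3,4) by blast
    then show "rank L x < rank L y"
      unfolding rank_def by (rule psubset_card_mono[OF fin])
  next
    assume less: "rank L x < rank L y"
    show "(y, x) \<notin> L"
    proof
      assume "(y, x) \<in> L"
      then have "rank L y \<le> rank L x"
        unfolding rank_def by (intro card_mono[OF fin]) (auto intro: tr)
      with less show False by simp
    qed
  qed
qed

lemma realizer_not_above_iff:
  assumes P: "partial_order_on S P" and R: "realizer S P R" and x: "x \<in> S" and y: "y \<in> S"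
  shows "(y, x) \<notin> P \<longleftrightarrow> (\<exists>L\<in>R. (y, x) \<notin> L)"
proof
  assume nP: "(y, x) \<notin> P"
  then have ne: "x \<noteq> y"
    using P x by (auto simp: partial_order_on_def preorder_on_def refl_on_def)
  have "\<exists>L\<in>R. (x, y) \<in> L"
  proof (cases "(x, y) \<in> P")
    case True
    \<comment> \<open>Every extension contains \<open>(x, y)\<close>, and a realizer, being
      nonempty, has at least one.\<close>
    then show ?thesis
      using R unfolding realizer_def linear_extension_def by blast
  next
    case False
    then show ?thesis
      using R nP x y unfolding realizer_def by blast
  qed
  then obtain L where "L \<in> R" "(x, y) \<in> L" by blast
  moreover have "antisym L"
    using R \<open>L \<in> R\<close>
    by (auto simp: realizer_def linear_extension_def linear_order_on_def partial_order_on_def)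
  ultimately show "\<exists>L\<in>R. (y, x) \<notin> L"
    using ne by (auto dest: antisymD)
next
  assume "\<exists>L\<in>R. (y, x) \<notin> L"
  then show "(y, x) \<notin> P"
    using R unfolding realizer_def linear_extension_def by blast
qed

section \<open>Covering the complement by one threshold graph per order of a realizer\<close>

theorem theorem4:
  fixes S :: "'a set" and P :: "'a rel" and n :: nat and g :: "nat \<Rightarrow> 'a"
  assumes "partial_order_on S P"
    and "finite S" and "card S = n"
    and "bij_betw g {1..n} S"
  shows "poset_dim S P \<ge> threshold_dim (complement_graph (poset_graph S P n g))"
proof -
  obtain R where fin: "finite R" and card: "card R = poset_dim S P" and R: "realizer S P R"
    using poset_dim_realizer assms(1,2) by metis
  let ?G = "complement_graph (poset_graph S P n g)"
  define V where "V = S <+> {1..n}"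
  \<comment> \<open>As ranks are at most \<open>n\<close>, the shift by \<open>n + 1\<close> makes
    weights at least 1 on \<open>S\<close> and at most -1 on \<open>{1..n}\<close>, which decides
    all unmixed pairs against the threshold 1.\<close>
  define w where "w L = case_sum (\<lambda>u. real n + 1 - real (rank L u))
    (\<lambda>v. real (rank L (g v)) - (real n + 1))" for L
  define H where "H L = weight_graph V 1 (w L)" for L
  have lin: "linear_order_on S L" if "L \<in> R" for L
    using R that by (auto simp: realizer_def linear_extension_def)
  have rank_le: "rank L x \<le> n" if "L \<in> R" for L x
    using rank_le_card[OF assms(2) lin[OF that]] assms(3) by simp
  have gS: "g i \<in> S" if "i \<in> {1..n}" for i
    using assms(4) that by (auto dest: bij_betwE)
  have vG: "verts ?G = V"
    by (simp add: complement_graph_def poset_graph_def V_def)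
  have clique: "{Inl x, Inl y} \<in> edges (H L)"
    if "L \<in> R" "x \<in> S" "y \<in> S" "x \<noteq> y" for L x y
    using that rank_le[OF that(1), of x] rank_le[OF that(1), of y]
    by (simp add: H_def edge_weight_graph_iff V_def InlI w_def)
  have indep: "{Inr i, Inr j} \<notin> edges (H L)"
    if "L \<in> R" "i \<in> {1..n}" "j \<in> {1..n}" "i \<noteq> j" for L i j
    using that rank_le[OF that(1), of "g i"] rank_le[OF that(1), of "g j"]
    by (simp add: H_def edge_weight_graph_iff V_def InrI w_def)
  have cross: "{Inl x, Inr j} \<in> edges (H L) \<longleftrightarrow> (g j, x) \<notin> L"
    if "L \<in> R" "x \<in> S" "j \<in> {1..n}" for L x j
  proof -
    \<comment> \<open>The shifts cancel, and a difference of natural numbers is at least 1 exactly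
      when it is positive.\<close>
    have "{Inl x, Inr j} \<in> edges (H L) \<longleftrightarrow> rank L x < rank L (g j)"
      using that by (simp add: H_def edge_weight_graph_iff V_def InlI InrI w_def) linarith
    then show ?thesis
      using rank_less_iff[OF assms(2) lin[OF that(1)] that(2) gS[OF that(3)]] by simp
  qed
  have G_clique: "{Inl x, Inl y} \<in> edges ?G" if "x \<in> S" "y \<in> S" "x \<noteq> y" for x y
    using that
    by (auto simp: complement_graph_def poset_graph_def pair_in_vertex_pairs_iff doubleton_eq_iff)
  have G_indep: "{Inr i, Inr j} \<notin> edges ?G" if "i \<in> {1..n}" "j \<in> {1..n}" "i \<noteq> j" for i j
    using that by (auto simp: complement_graph_def poset_graph_def)
  have G_cross: "{Inl x, Inr j} \<in> edges ?G \<longleftrightarrow> (g j, x) \<notin> P"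
    if "x \<in> S" "j \<in> {1..n}" for x j
    using that
    by (auto simp: complement_graph_def poset_graph_def pair_in_vertex_pairs_iff doubleton_eq_iff)
  have cross_iff: "{Inl x, Inr j} \<in> edges ?G \<longleftrightarrow> {Inl x, Inr j} \<in> (\<Union>L\<in>R. edges (H L))"
    if "x \<in> S" "j \<in> {1..n}" for x j
    using that G_cross cross realizer_not_above_iff[OF assms(1) R that(1) gS[OF that(2)]] by simp
  have "edges ?G = (\<Union>L\<in>R. edges (H L))"
  proof (rule edges_eqI[of _ V])
    show "edges ?G \<subseteq> vertex_pairs V"
      by (auto simp: complement_graph_def poset_graph_def V_def)
    show "(\<Union>L\<in>R. edges (H L)) \<subseteq> vertex_pairs V"
      using edges_weight_graph_subset unfolding H_def by blast
    fix a b assume ab: "a \<in> V" "b \<in> V" "a \<noteq> b"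
    \<comment> \<open>Every \<open>H L\<close> contains all edges inside \<open>S\<close>, so a
      single \<open>L\<close> covers them, but one has to exist.\<close>
    have "R \<noteq> {}"
      using R by (simp add: realizer_def)
    show "{a, b} \<in> edges ?G \<longleftrightarrow> {a, b} \<in> (\<Union>L\<in>R. edges (H L))"
    proof (cases a; cases b)
      fix x y assume "a = Inl x" "b = Inl y"
      then show ?thesis
        using ab G_clique clique \<open>R \<noteq> {}\<close> by (auto simp: V_def)
    next
      fix x j assume "a = Inl x" "b = Inr j"
      then show ?thesis
        using ab cross_iff[of x j] by (simp add: V_def Plus_def image_iff)
    next
      fix i y assume "a = Inr i" "b = Inl y"
      then show ?thesis
        using ab cross_iff[of y i] by (simp add: V_def Plus_def image_iff insert_commute)
    next
      fix i j assume "a = Inr i" "b = Inr j"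
      then show ?thesis
        using ab G_indep indep by (auto simp: V_def)
    qed
  qed
  then have "threshold_dim ?G \<le> card R"
    by (intro threshold_dim_le_card[OF fin]) (simp_all add: H_def vG threshold_graph_weight_graph)
  then show ?thesis
    by (simp add: card)
qed

end
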